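(* Let $\alpha,\beta$ be real numbers with $\alpha<\beta<-\alpha$, let $L(y)=(1-x^2)y''+(\alpha x+\beta)y'$, and let $$p(x)=\frac{1}{(1-x)^{\frac{\beta+\alpha+2}{2}}(1+x)^{\frac{-\beta+\alpha+2}{2}}},\qquad x\in(-1,1).$$ Then $\int_{-1}^{1}p(x)f(x)\,dx$ is finite for every polynomial $f$; the function $(1-x^2)p(x)$ vanishes (in the limit) at $x=-1$ and $x=1$; $L$ is self-adjoint on polynomials with respect to the inner product $(y,u)=\int_{-1}^{1}p(x)y(x)u(x)\,dx$, i.e. $(Ly,u)=(y,Lu)$ for all polynomials $y,u$; and for every integer $n\ge 0$ there is, up to a scalar, a unique polynomial of degree $n$ that is an eigenfunction of $L$, its eigenvalue being $-n(n-1)+n\alpha$. Consequently this polynomial satisfies $$(1-x^2)y''+(\alpha x+\beta)y'+\bigl(n(n-1)-n\alpha\bigr)y=0.$$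
   Context: All polynomials have real coefficients. The function $p$ is the natural weight of $L$, i.e. $p=\frac{1}{1-x^2}e^{\int\frac{\alpha x+\beta}{1-x^2}dx}$ on $(-1,1)$. *)

theory Defs
  imports "HOL-Analysis.Analysis" "HOL-Computational_Algebra.Polynomial"
begin

text \<open>The operator \<open>L(y) = (1 - x\<^sup>2) y'' + (\<alpha> x + \<beta>) y'\<close> on real polynomials.\<close>

definition L_op :: "real \<Rightarrow> real \<Rightarrow> real poly \<Rightarrow> real poly" where
  "L_op \<alpha> \<beta> y = [:1, 0, -1:] * pderiv (pderiv y) + [:\<beta>, \<alpha>:] * pderiv y"

text \<open>Only the values on the open interval \<open>(-1,1)\<close>, where both bases are positive,
  are meaningful.\<close>

definition weight :: "real \<Rightarrow> real \<Rightarrow> real \<Rightarrow> real" where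
  "weight \<alpha> \<beta> x =
     1 / ((1 - x) powr ((\<beta> + \<alpha> + 2) / 2) * (1 + x) powr ((- \<beta> + \<alpha> + 2) / 2))"

text \<open>The Lebesgue integral returns 0 for non-integrable functions, so this is the
  intended pairing only together with integrability of weight times polynomial.\<close>

definition weighted_inner :: "real \<Rightarrow> real \<Rightarrow> real poly \<Rightarrow> real poly \<Rightarrow> real" where
  "weighted_inner \<alpha> \<beta> y u =
     (LINT x:{-1<..<1}|lborel. weight \<alpha> \<beta> x * poly y x * poly u x)"

definition eigenpoly :: "(real poly \<Rightarrow> real poly) \<Rightarrow> real \<Rightarrow> real poly \<Rightarrow> bool" where
  "eigenpoly T ev y \<longleftrightarrow> y \<noteq> 0 \<and> T y = smult ev y"

text \<open>The explicit weight is the natural weight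
  \<open>(1 - x\<^sup>2)\<^sup>-\<^sup>1 exp (\<integral> (\<alpha> x + \<beta>) / (1 - x\<^sup>2) dx)\<close> of the operator.\<close>

lemma weight_natural:
  fixes \<alpha> \<beta> :: real
  shows "\<exists>F. \<forall>x\<in>{-1<..<1}.
     (F has_real_derivative (\<alpha> * x + \<beta>) / (1 - x\<^sup>2)) (at x) \<and>
     weight \<alpha> \<beta> x = 1 / (1 - x\<^sup>2) * exp (F x)"
proof (intro exI ballI conjI)
  fix x :: real assume x: "x \<in> {-1<..<1}"
  let ?F = "\<lambda>x::real. - ((\<alpha> + \<beta>) / 2) * ln (1 - x) + ((\<beta> - \<alpha>) / 2) * ln (1 + x)"
  have fac: "1 - x\<^sup>2 = (1 - x) * (1 + x)" by (simp add: power2_eq_square algebra_simps)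
  have nz: "1 - x > 0" "1 + x > 0" using x by auto
  have num: "(\<alpha> + \<beta>) / 2 * (1 + x) + (\<beta> - \<alpha>) / 2 * (1 - x) = \<alpha> * x + \<beta>"
    by (simp add: field_simps)
  have pf: "(\<alpha> + \<beta>) / 2 / (1 - x) + (\<beta> - \<alpha>) / 2 / (1 + x) = (\<alpha> * x + \<beta>) / (1 - x\<^sup>2)"
    using nz unfolding fac num [symmetric] by (intro add_frac_eq) auto
  have "((\<lambda>x. ln (1 - x)) has_real_derivative - 1 / (1 - x)) (at x)"
    "((\<lambda>x. ln (1 + x)) has_real_derivative 1 / (1 + x)) (at x)"
    using nz by (auto intro!: derivative_eq_intros)
  from DERIV_add [OF DERIV_cmult [OF this(1), of "- ((\<alpha> + \<beta>) / 2)"]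
      DERIV_cmult [OF this(2), of "(\<beta> - \<alpha>) / 2"]]
  have "(?F has_real_derivative (\<alpha> + \<beta>) / 2 / (1 - x) + (\<beta> - \<alpha>) / 2 / (1 + x)) (at x)"
    by simp
  then show "(?F has_real_derivative (\<alpha> * x + \<beta>) / (1 - x\<^sup>2)) (at x)" by (simp only: pf)
  have 1: "(1 - x) powr ((\<beta> + \<alpha> + 2) / 2) = (1 - x) * exp ((\<alpha> + \<beta>) / 2 * ln (1 - x))"
    using nz by (simp add: powr_def add_divide_distrib distrib_right exp_add add.commute)
  have 2: "(1 + x) powr ((- \<beta> + \<alpha> + 2) / 2) = (1 + x) * exp (- ((\<beta> - \<alpha>) / 2 * ln (1 + x)))"
  proof -
    have "(- \<beta> + \<alpha> + 2) / 2 * ln (1 + x) = ln (1 + x) + - ((\<beta> - \<alpha>) / 2 * ln (1 + x))"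
      by (simp add: field_simps)
    then have "exp ((- \<beta> + \<alpha> + 2) / 2 * ln (1 + x)) =
        exp (ln (1 + x)) * exp (- ((\<beta> - \<alpha>) / 2 * ln (1 + x)))"
      by (simp only: exp_add)
    then show ?thesis using nz by (simp add: powr_def)
  qed
  have e: "exp (?F x) = inverse (exp ((\<alpha> + \<beta>) / 2 * ln (1 - x))) *
      inverse (exp (- ((\<beta> - \<alpha>) / 2 * ln (1 + x))))"
    by (simp flip: exp_minus exp_add)
  show "weight \<alpha> \<beta> x = 1 / (1 - x\<^sup>2) * exp (?F x)"
    unfolding weight_def 1 2 fac e by (simp only: divide_inverse inverse_mult_distrib mult_ac mult_1_left)
qed

end

theory Submission
  imports Defs
begin

text \<open>The weight is an affinely transformed Beta density, which gives integrability. Since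
  \<open>((1 - x\<^sup>2) p)' = (\<alpha> x + \<beta>) p\<close>, the difference \<open>p (L y) u - p y (L u)\<close> is the derivative of
  \<open>(1 - x\<^sup>2) p (y' u - y u')\<close>, which vanishes at both end points.
  On the monomial basis \<open>L\<close> is upper triangular with diagonal entries \<open>-n(n-1) + n\<alpha>\<close>; these are
  pairwise distinct because \<open>\<alpha> < 0\<close>, so each degree carries exactly one eigenpolynomial.\<close>

section \<open>The weight\<close>

text \<open>The exponents take the Beta form b - 1 and a - 1 with b = -(\<beta> + \<alpha>)/2 and a
  = (\<beta> - \<alpha>)/2; the condition \<alpha> < \<beta> < -\<alpha> says exactly that a and b
  are positive.\<close>

lemma weight_eq_powr:
  "weight \<alpha> \<beta> x = (1 - x) powr (- (\<beta> + \<alpha>) / 2 - 1) * (1 + x) powr ((\<beta> - \<alpha>) / 2 - 1)"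
proof -
  have "- (\<beta> + \<alpha>) / 2 - 1 = - ((\<beta> + \<alpha> + 2) / 2)" "(\<beta> - \<alpha>) / 2 - 1 = - ((- \<beta> + \<alpha> + 2) / 2)"
    by (simp_all add: field_simps)
  then show ?thesis
    unfolding weight_def by (simp only: powr_minus divide_inverse inverse_mult_distrib mult_1_left)
qed

lemma set_integrable_weight:
  assumes "\<alpha> < \<beta>" "\<beta> < - \<alpha>"
  shows "set_integrable lborel {-1<..<1} (weight \<alpha> \<beta>)"
proof -
  define a where "a = (\<beta> - \<alpha>) / 2"
  define b where "b = - (\<beta> + \<alpha>) / 2"
  have "a > 0" "b > 0" using assms by (auto simp: a_def b_def)
  then have "set_integrable lborel {0<..<1} (\<lambda>t::real. t powr (a - 1) * (1 - t) powr (b - 1))"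
    by (rule set_integrable_subset [OF integrable_Beta]) auto
  then have "integrable lborel (\<lambda>t::real. indicator {0<..<1} t *\<^sub>R (t powr (a - 1) * (1 - t) powr (b - 1)))"
    unfolding set_integrable_def .
  \<comment> \<open>The substitution t = (1 + x)/2 maps (-1,1) onto (0,1), with 1 - t = (1 - x)/2.
    The constant powers of 2 cancel the denominators that arise under \<open>powr\<close>.\<close>
  from lborel_integrable_real_affine [OF this, of "1 / 2" "1 / 2"]
  have "integrable lborel (\<lambda>x::real. 2 powr (a - 1) * 2 powr (b - 1) *
      (indicator {0<..<1} (1 / 2 + 1 / 2 * x) *\<^sub>R
        ((1 / 2 + 1 / 2 * x) powr (a - 1) * (1 - (1 / 2 + 1 / 2 * x)) powr (b - 1))))"
    by (intro integrable_mult_right) simp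
  also have "(\<lambda>x::real. 2 powr (a - 1) * 2 powr (b - 1) *
      (indicator {0<..<1} (1 / 2 + 1 / 2 * x) *\<^sub>R
        ((1 / 2 + 1 / 2 * x) powr (a - 1) * (1 - (1 / 2 + 1 / 2 * x)) powr (b - 1))))
      = (\<lambda>x. indicator {-1<..<1} x *\<^sub>R weight \<alpha> \<beta> x)"
  proof
    fix x :: real
    have 1: "1 / 2 + 1 / 2 * x = (1 + x) / 2" "1 - (1 + x) / 2 = (1 - x) / 2"
      by (simp_all add: field_simps)
    have 2: "indicator {0<..<1} ((1 + x) / 2) = (indicator {-1<..<1} x :: real)"
      by (auto simp: indicator_def)
    show "2 powr (a - 1) * 2 powr (b - 1) * (indicator {0<..<1} (1 / 2 + 1 / 2 * x) *\<^sub>R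
        ((1 / 2 + 1 / 2 * x) powr (a - 1) * (1 - (1 / 2 + 1 / 2 * x)) powr (b - 1)))
      = indicator {-1<..<1} x *\<^sub>R weight \<alpha> \<beta> x"
      unfolding 1 2 weight_eq_powr a_def [symmetric] b_def [symmetric]
      by (auto simp: indicator_def powr_divide)
  qed
  finally show ?thesis unfolding set_integrable_def .
qed

text \<open>A polynomial is bounded on the compact interval [-1,1], so a constant multiple of the
  weight dominates the product.\<close>

lemma set_integrable_weight_mult_poly:
  assumes "\<alpha> < \<beta>" "\<beta> < - \<alpha>"
  shows "set_integrable lborel {-1<..<1} (\<lambda>x. weight \<alpha> \<beta> x * poly f x)"
proof -
  have "bounded (poly f ` {-1..1})"
    by (intro compact_imp_bounded compact_continuous_image continuous_intros) simp
  then obtain B where B: "\<And>x. x \<in> {-1..1} \<Longrightarrow> \<bar>poly f x\<bar> \<le> B"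
    unfolding bounded_iff by (metis imageI real_norm_def)
  have "set_integrable lborel {-1<..<1} (\<lambda>x. B * weight \<alpha> \<beta> x)"
    using set_integrable_weight [OF assms] by simp
  then show ?thesis
  proof (rule set_integrable_bound)
    have "poly f \<in> borel_measurable borel"
      by (intro borel_measurable_continuous_onI continuous_intros)
    then show "set_borel_measurable lborel {-1<..<1} (\<lambda>x. weight \<alpha> \<beta> x * poly f x)"
      unfolding set_borel_measurable_def weight_def by measurable
    have "norm (weight \<alpha> \<beta> x * poly f x) \<le> norm (B * weight \<alpha> \<beta> x)" if "x \<in> {-1<..<1}" for x
    proof -
      have "\<bar>poly f x\<bar> \<le> \<bar>B\<bar>" using B [of x] that by auto
      then show ?thesis by (simp add: abs_mult mult.commute [of "weight \<alpha> \<beta> x"] mult_right_mono)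
    qed
    then show "AE x in lborel. x \<in> {-1<..<1} \<longrightarrow>
        norm (weight \<alpha> \<beta> x * poly f x) \<le> norm (B * weight \<alpha> \<beta> x)"
      by simp
  qed
qed

text \<open>The factors 1 - x and 1 + x each raise one exponent by one. For \<alpha> < \<beta> <
  -\<alpha> the new exponents are positive, which makes the product vanish at the end
  points.\<close>

lemma one_minus_square_weight:
  assumes "x \<in> {-1<..<1}"
  shows "(1 - x\<^sup>2) * weight \<alpha> \<beta> x = (1 - x) powr (- (\<beta> + \<alpha>) / 2) * (1 + x) powr ((\<beta> - \<alpha>) / 2)"
proof -
  have "1 - x\<^sup>2 = (1 - x) * (1 + x)" by (simp add: power2_eq_square algebra_simps)
  moreover have "(1 - x) powr (- (\<beta> + \<alpha>) / 2) = (1 - x) * (1 - x) powr (- (\<beta> + \<alpha>) / 2 - 1)"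
    "(1 + x) powr ((\<beta> - \<alpha>) / 2) = (1 + x) * (1 + x) powr ((\<beta> - \<alpha>) / 2 - 1)"
    using assms by (simp_all add: powr_diff)
  ultimately show ?thesis by (simp only: weight_eq_powr mult_ac)
qed

lemma tendsto_one_minus_square_weight:
  assumes "\<alpha> < \<beta>" "\<beta> < - \<alpha>"
  shows "((\<lambda>x. (1 - x\<^sup>2) * weight \<alpha> \<beta> x) \<longlongrightarrow> 0) (at_right (-1))"
    and "((\<lambda>x. (1 - x\<^sup>2) * weight \<alpha> \<beta> x) \<longlongrightarrow> 0) (at_left 1)"
proof -
  let ?q = "\<lambda>x::real. (1 - x) powr (- (\<beta> + \<alpha>) / 2) * (1 + x) powr ((\<beta> - \<alpha>) / 2)"
  have R: "eventually (\<lambda>x::real. x \<in> {-1<..<1}) (at_right (-1))"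
    by (rule eventually_at_right_real) simp
  have L: "eventually (\<lambda>x::real. x \<in> {-1<..<1}) (at_left 1)"
    by (rule eventually_at_left_real) simp
  \<comment> \<open>Only the base 1 + x tends to 0; its exponent is positive and it is eventually
    nonnegative, as \<open>tendsto_powr'\<close> requires in that case.\<close>
  have "(?q \<longlongrightarrow> (1 - (-1)) powr (- (\<beta> + \<alpha>) / 2) * (1 + (-1)) powr ((\<beta> - \<alpha>) / 2)) (at_right (-1))"
    using assms by (intro tendsto_intros tendsto_powr') (auto intro: eventually_mono [OF R])
  then show "((\<lambda>x. (1 - x\<^sup>2) * weight \<alpha> \<beta> x) \<longlongrightarrow> 0) (at_right (-1))"
    by (subst tendsto_cong [OF eventually_mono [OF R one_minus_square_weight]]) simp_all
  have "(?q \<longlongrightarrow> (1 - 1) powr (- (\<beta> + \<alpha>) / 2) * (1 + 1) powr ((\<beta> - \<alpha>) / 2)) (at_left 1)"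
    using assms by (intro tendsto_intros tendsto_powr') (auto intro: eventually_mono [OF L])
  then show "((\<lambda>x. (1 - x\<^sup>2) * weight \<alpha> \<beta> x) \<longlongrightarrow> 0) (at_left 1)"
    by (subst tendsto_cong [OF eventually_mono [OF L one_minus_square_weight]]) simp_all
qed

text \<open>By \<open>weight_natural\<close> the function equals \<open>exp (F x)\<close> on the
  open interval, where F has derivative (\<alpha> x + \<beta>)/(1 - x^2); the chain rule then
  reproduces the weight.\<close>

lemma has_real_derivative_one_minus_square_weight:
  assumes x: "x \<in> {-1<..<1}"
  shows "((\<lambda>x. (1 - x\<^sup>2) * weight \<alpha> \<beta> x) has_real_derivative (\<alpha> * x + \<beta>) * weight \<alpha> \<beta> x) (at x)"
proof -
  obtain F where F: "\<And>x. x \<in> {-1<..<1} \<Longrightarrow>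
      (F has_real_derivative (\<alpha> * x + \<beta>) / (1 - x\<^sup>2)) (at x)"
    and w: "\<And>x. x \<in> {-1<..<1} \<Longrightarrow> weight \<alpha> \<beta> x = 1 / (1 - x\<^sup>2) * exp (F x)"
    using weight_natural [of \<alpha> \<beta>] by blast
  have nz: "z\<^sup>2 \<noteq> 1" if "z \<in> {-1<..<1}" for z :: real
    using that abs_square_less_1 [of z] by auto
  have "((\<lambda>x. exp (F x)) has_real_derivative exp (F x) * ((\<alpha> * x + \<beta>) / (1 - x\<^sup>2))) (at x)"
    by (rule DERIV_fun_exp [OF F [OF x]])
  also have "exp (F x) * ((\<alpha> * x + \<beta>) / (1 - x\<^sup>2)) = (\<alpha> * x + \<beta>) * weight \<alpha> \<beta> x"
    by (simp add: w [OF x])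
  finally show ?thesis
    by (rule has_field_derivative_transform_within_open [OF _ open_greaterThanLessThan x])
      (simp add: w nz)
qed

section \<open>Symmetry\<close>

lemma weighted_inner_L_op_commute:
  assumes "\<alpha> < \<beta>" "\<beta> < - \<alpha>"
  shows "weighted_inner \<alpha> \<beta> (L_op \<alpha> \<beta> y) u = weighted_inner \<alpha> \<beta> y (L_op \<alpha> \<beta> u)"
proof -
  define w where "w = weight \<alpha> \<beta>"
  \<comment> \<open>Up to sign this is the Wronskian of y and u; in its derivative the products of
    first derivatives cancel, leaving y'' u - y u''.\<close>
  define W where "W = pderiv y * u - y * pderiv u"
  define G where "G = L_op \<alpha> \<beta> y * u - y * L_op \<alpha> \<beta> u"
  define F where "F = (\<lambda>x. (1 - x\<^sup>2) * w x * poly W x)"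
  have deriv: "(F has_real_derivative w x * poly G x) (at x)" if "x \<in> {-1<..<1}" for x
  proof -
    have "(F has_real_derivative (\<alpha> * x + \<beta>) * w x * poly W x + poly (pderiv W) x * ((1 - x\<^sup>2) * w x)) (at x)"
      unfolding F_def w_def
      by (intro DERIV_mult has_real_derivative_one_minus_square_weight poly_DERIV that)
    also have "(\<alpha> * x + \<beta>) * w x * poly W x + poly (pderiv W) x * ((1 - x\<^sup>2) * w x) = w x * poly G x"
      by (simp add: W_def G_def L_op_def pderiv_diff pderiv_mult power2_eq_square algebra_simps)
    finally show ?thesis .
  qed
  have contw: "isCont w x" if "x \<in> {-1<..<1}" for x
    unfolding w_def weight_eq_powr using that by (intro continuous_intros) auto
  have lim: "(F \<longlongrightarrow> 0 * poly W (-1)) (at_right (-1))" "(F \<longlongrightarrow> 0 * poly W 1) (at_left 1)"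
    unfolding F_def w_def
    by (intro tendsto_mult tendsto_one_minus_square_weight assms tendsto_poly tendsto_ident_at)+
  have int: "set_integrable lborel {-1<..<1} (\<lambda>x. w x * poly f x)" for f
    unfolding w_def by (rule set_integrable_weight_mult_poly [OF assms])
  have eint: "einterval (ereal (-1)) (ereal 1) = {-1<..<1}" by (auto simp: einterval_def)
  \<comment> \<open>The weight may be unbounded near the end points, so the fundamental theorem is
    used in the form that takes one-sided limits of F as boundary values and integrability as a
    premise.\<close>
  have "(LBINT x=ereal (-1)..ereal 1. w x * poly G x) = 0 - 0"
  proof (rule interval_integral_FTC_integrable)
    show "(F has_vector_derivative w x * poly G x) (at x)"
      if "ereal (-1) < ereal x" "ereal x < ereal 1" for x
      using deriv [of x] that by (simp add: has_real_derivative_iff_has_vector_derivative)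
    show "isCont (\<lambda>x. w x * poly G x) x" if "ereal (-1) < ereal x" "ereal x < ereal 1" for x
      using that by (intro continuous_intros contw) auto
    show "set_integrable lborel (einterval (ereal (-1)) (ereal 1)) (\<lambda>x. w x * poly G x)"
      unfolding eint by (rule int)
    show "((F \<circ> real_of_ereal) \<longlongrightarrow> 0) (at_right (ereal (-1)))"
      "((F \<circ> real_of_ereal) \<longlongrightarrow> 0) (at_left (ereal 1))"
      using lim unfolding ereal_tendsto_simps1 by simp_all
  qed simp
  then have "(LINT x:{-1<..<1}|lborel. w x * poly G x) = 0"
    using interval_lebesgue_integral_le_eq [of "ereal (-1)" "ereal 1" lborel "\<lambda>x. w x * poly G x"]
    unfolding eint by simp
  also have "(\<lambda>x. w x * poly G x)
      = (\<lambda>x. w x * poly (L_op \<alpha> \<beta> y * u) x - w x * poly (y * L_op \<alpha> \<beta> u) x)"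
    by (simp add: G_def algebra_simps)
  \<comment> \<open>Splitting the integral is legitimate because both parts are integrable, being
    weight times polynomial.\<close>
  finally have "(LINT x:{-1<..<1}|lborel. w x * poly (L_op \<alpha> \<beta> y * u) x)
      - (LINT x:{-1<..<1}|lborel. w x * poly (y * L_op \<alpha> \<beta> u) x) = 0"
    by (subst (asm) set_integral_diff(2) [OF int int])
  then show ?thesis
    by (simp add: weighted_inner_def w_def mult.assoc)
qed

section \<open>Eigenpolynomials\<close>

text \<open>The diagonal entry of L at x^n in the monomial basis.\<close>

definition L_ev :: "real \<Rightarrow> nat \<Rightarrow> real" where
  "L_ev \<alpha> n = - (real n * (real n - 1)) + real n * \<alpha>"

text \<open>The difference of the two values is (m - n)(\<alpha> + 1 - m - n). If the second factor
  vanishes, then m + n < 1, so m and n are both 0.\<close>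

lemma L_ev_inj:
  assumes "\<alpha> < 0" "L_ev \<alpha> m = L_ev \<alpha> n"
  shows "m = n"
proof (rule ccontr)
  assume "m \<noteq> n"
  have "(real m - real n) * (\<alpha> + 1 - real m - real n) = 0"
    using assms(2) by (simp add: L_ev_def algebra_simps)
  then have "real m + real n < 1" using \<open>m \<noteq> n\<close> assms(1) by simp
  then show False using \<open>m \<noteq> n\<close> by linarith
qed

text \<open>This is row k of the matrix of L: only the diagonal and the two entries to its right
  occur, so L is upper triangular.\<close>

lemma coeff_L_op:
  "coeff (L_op \<alpha> \<beta> y) k = L_ev \<alpha> k * coeff y k + \<beta> * (real k + 1) * coeff y (k + 1)
     + (real k + 1) * (real k + 2) * coeff y (k + 2)"
proof -
  \<comment> \<open>Multiplication by x is written as \<open>pCons 0\<close>, so that coefficients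
    can be read off by cases on k.\<close>
  have eq: "L_op \<alpha> \<beta> y = pderiv (pderiv y) - pCons 0 (pCons 0 (pderiv (pderiv y)))
      + smult \<beta> (pderiv y) + smult \<alpha> (pCons 0 (pderiv y))"
    by (simp add: L_op_def mult_pCons_left)
  show ?thesis
    unfolding eq coeff_add coeff_diff coeff_smult coeff_pCons coeff_pderiv L_ev_def
    by (auto simp: algebra_simps coeff_pderiv split: nat.split)
qed

lemma L_op_add: "L_op \<alpha> \<beta> (y + u) = L_op \<alpha> \<beta> y + L_op \<alpha> \<beta> u"
  by (simp add: L_op_def pderiv_add distrib_left)

lemma L_op_smult: "L_op \<alpha> \<beta> (smult c y) = smult c (L_op \<alpha> \<beta> y)"
  by (simp add: L_op_def pderiv_smult smult_add_right)

text \<open>Comparing leading coefficients suffices, since the off-diagonal terms involve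
  coefficients above the degree.\<close>

lemma L_op_eigenvalue:
  assumes "L_op \<alpha> \<beta> y = smult ev y" "y \<noteq> 0"
  shows "ev = L_ev \<alpha> (degree y)"
proof -
  have "coeff (L_op \<alpha> \<beta> y) (degree y) = L_ev \<alpha> (degree y) * lead_coeff y"
    by (simp add: coeff_L_op coeff_eq_0)
  then show ?thesis using assms by simp
qed

text \<open>Back substitution: below index n the diagonal entries of L minus
  \<open>L_ev \<alpha> n\<close> are nonzero. Expressing the degree bound through vanishing
  coefficients lets m = 0 stand for the zero polynomial.\<close>

lemma L_op_minus_ev_surj_low_degree:
  assumes "\<alpha> < 0" "m \<le> n" "\<And>i. m \<le> i \<Longrightarrow> coeff f i = 0"
  shows "\<exists>g. (\<forall>i\<ge>m. coeff g i = 0) \<and> L_op \<alpha> \<beta> g - smult (L_ev \<alpha> n) g = f"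
  using assms(2,3)
proof (induction m arbitrary: f)
  case 0
  then have "f = 0" by (simp add: poly_eq_iff)
  then show ?case by (intro exI [of _ 0]) (simp add: L_op_def)
next
  case (Suc m)
  define d where "d = L_ev \<alpha> m - L_ev \<alpha> n"
  have "d \<noteq> 0" using L_ev_inj [OF assms(1), of m n] Suc.prems(1) by (auto simp: d_def)
  \<comment> \<open>The diagonal entry at index m is d, so h reproduces the top coefficient of f and
    the remainder r falls under the induction hypothesis.\<close>
  define h where "h = monom (coeff f m / d) m"
  define r where "r = f - (L_op \<alpha> \<beta> h - smult (L_ev \<alpha> n) h)"
  have "coeff r i = 0" if "m \<le> i" for i
  proof (cases "i = m")
    case True
    have "coeff r m = coeff f m - d * (coeff f m / d)"
      unfolding d_def left_diff_distrib by (simp add: r_def h_def coeff_L_op flip: d_def)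
    then show ?thesis using True \<open>d \<noteq> 0\<close> by simp
  next
    case False
    then show ?thesis using that Suc.prems(2) [of i] by (simp add: r_def h_def coeff_L_op)
  qed
  then obtain g where g: "\<forall>i\<ge>m. coeff g i = 0" "L_op \<alpha> \<beta> g - smult (L_ev \<alpha> n) g = r"
    using Suc by (metis Suc_leD)
  show ?case
  proof (intro exI [of _ "g + h"] conjI)
    show "\<forall>i\<ge>Suc m. coeff (g + h) i = 0" using g(1) by (simp add: h_def)
    show "L_op \<alpha> \<beta> (g + h) - smult (L_ev \<alpha> n) (g + h) = f"
      using g(2) by (simp add: r_def L_op_add smult_add_right algebra_simps)
  qed
qed

text \<open>The ansatz is x^n + g with g of lower degree. Applying L minus the eigenvalue to x^n
  kills the coefficient of x^n, and g is solved to cancel the rest.\<close>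

lemma ex_eigenpoly_L_op:
  assumes "\<alpha> < 0"
  shows "\<exists>y. degree y = n \<and> eigenpoly (L_op \<alpha> \<beta>) (L_ev \<alpha> n) y"
proof -
  define h :: "real poly" where "h = monom 1 n"
  have "coeff (smult (L_ev \<alpha> n) h - L_op \<alpha> \<beta> h) i = 0" if "n \<le> i" for i
    using that by (auto simp: h_def coeff_L_op)
  from L_op_minus_ev_surj_low_degree [OF assms order_refl this]
  obtain g where g: "\<forall>i\<ge>n. coeff g i = 0"
    "L_op \<alpha> \<beta> g - smult (L_ev \<alpha> n) g = smult (L_ev \<alpha> n) h - L_op \<alpha> \<beta> h"
    by blast
  have "coeff (g + h) n = 1" using g(1) by (simp add: h_def)
  moreover have "degree (g + h) \<le> n" using g(1) by (intro degree_le) (simp add: h_def)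
  ultimately have "degree (g + h) = n" "g + h \<noteq> 0"
    by (metis le_antisym le_degree zero_neq_one, metis coeff_0 zero_neq_one)
  moreover have "L_op \<alpha> \<beta> (g + h) = smult (L_ev \<alpha> n) (g + h)"
    using g(2) by (simp add: L_op_add smult_add_right algebra_simps)
  ultimately show ?thesis unfolding eigenpoly_def by blast
qed

lemma eigenpoly_L_op_unique:
  assumes "\<alpha> < 0" "eigenpoly (L_op \<alpha> \<beta>) ev y" "eigenpoly (L_op \<alpha> \<beta>) ev' u" "degree u = degree y"
  shows "\<exists>c. u = smult c y"
proof -
  have y: "y \<noteq> 0" "L_op \<alpha> \<beta> y = smult ev y" and u: "u \<noteq> 0" "L_op \<alpha> \<beta> u = smult ev' u"
    using assms(2,3) by (auto simp: eigenpoly_def)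
  have ev: "ev = L_ev \<alpha> (degree y)" "ev' = L_ev \<alpha> (degree y)"
    using L_op_eigenvalue y u assms(4) by metis+
  \<comment> \<open>Equal degrees force equal eigenvalues, so d = u - c y satisfies the same
    eigenvalue equation. This c cancels the leading terms, whereas a nonzero d would need degree
    exactly \<open>degree y\<close>.\<close>
  define c where "c = lead_coeff u / lead_coeff y"
  define d where "d = u + smult (- c) y"
  have Ld: "L_op \<alpha> \<beta> d = smult (L_ev \<alpha> (degree y)) d"
    using y(2) u(2) ev by (simp add: d_def L_op_add L_op_smult smult_add_right mult.commute del: smult_minus_left)
  have "d = 0"
  proof (rule ccontr)
    assume "d \<noteq> 0"
    then have "degree d = degree y"
      using L_ev_inj [OF assms(1)] L_op_eigenvalue [OF Ld] by metis
    moreover have "coeff d (degree y) = 0"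
      using y(1) assms(4) by (simp add: d_def c_def)
    ultimately show False using \<open>d \<noteq> 0\<close> by (metis leading_coeff_0_iff)
  qed
  then have "u = smult c y" by (simp add: d_def)
  then show ?thesis ..
qed

theorem mainTheorem2:
  fixes \<alpha> \<beta> :: real
  assumes "\<alpha> < \<beta>" and "\<beta> < - \<alpha>"
  shows "(\<forall>f :: real poly. set_integrable lborel {-1<..<1} (\<lambda>x. weight \<alpha> \<beta> x * poly f x))
    \<and> ((\<lambda>x. (1 - x\<^sup>2) * weight \<alpha> \<beta> x) \<longlongrightarrow> 0) (at_right (-1))
    \<and> ((\<lambda>x. (1 - x\<^sup>2) * weight \<alpha> \<beta> x) \<longlongrightarrow> 0) (at_left 1)
    \<and> (\<forall>y u :: real poly.
          weighted_inner \<alpha> \<beta> (L_op \<alpha> \<beta> y) u = weighted_inner \<alpha> \<beta> y (L_op \<alpha> \<beta> u))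
    \<and> (\<forall>n :: nat. \<exists>y :: real poly.
          degree y = n
        \<and> eigenpoly (L_op \<alpha> \<beta>) (- (real n * (real n - 1)) + real n * \<alpha>) y
        \<and> (\<forall>u ev. degree u = n \<and> eigenpoly (L_op \<alpha> \<beta>) ev u \<longrightarrow> (\<exists>c. u = smult c y))
        \<and> (\<forall>x. (1 - x\<^sup>2) * poly (pderiv (pderiv y)) x + (\<alpha> * x + \<beta>) * poly (pderiv y) x
               + (real n * (real n - 1) - real n * \<alpha>) * poly y x = 0))"
proof -
  have "\<alpha> < 0" using assms by simp
  have "\<exists>y :: real poly.
          degree y = n
        \<and> eigenpoly (L_op \<alpha> \<beta>) (- (real n * (real n - 1)) + real n * \<alpha>) y
        \<and> (\<forall>u ev. degree u = n \<and> eigenpoly (L_op \<alpha> \<beta>) ev u \<longrightarrow> (\<exists>c. u = smult c y))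
        \<and> (\<forall>x. (1 - x\<^sup>2) * poly (pderiv (pderiv y)) x + (\<alpha> * x + \<beta>) * poly (pderiv y) x
               + (real n * (real n - 1) - real n * \<alpha>) * poly y x = 0)" for n :: nat
  proof -
    obtain y where y: "degree y = n" "eigenpoly (L_op \<alpha> \<beta>) (L_ev \<alpha> n) y"
      using ex_eigenpoly_L_op [OF \<open>\<alpha> < 0\<close>] by blast
    have "(1 - x\<^sup>2) * poly (pderiv (pderiv y)) x + (\<alpha> * x + \<beta>) * poly (pderiv y) x
               + (real n * (real n - 1) - real n * \<alpha>) * poly y x = 0" for x
    proof -
      \<comment> \<open>The differential equation is the eigenvalue equation evaluated at x.\<close>
      have "poly (L_op \<alpha> \<beta> y) x = L_ev \<alpha> n * poly y x"
        using y(2) by (simp add: eigenpoly_def)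
      then show ?thesis
        by (simp add: L_op_def L_ev_def power2_eq_square algebra_simps)
    qed
    moreover have "\<exists>c. u = smult c y" if "degree u = n" "eigenpoly (L_op \<alpha> \<beta>) ev u" for u ev
      using eigenpoly_L_op_unique [OF \<open>\<alpha> < 0\<close> y(2) that(2)] y(1) that(1) by simp
    ultimately show ?thesis using y unfolding L_ev_def by blast
  qed
  then show ?thesis
    using set_integrable_weight_mult_poly [OF assms] tendsto_one_minus_square_weight [OF assms]
      weighted_inner_L_op_commute [OF assms]
    by blast
qed

end
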